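(* Let $\mathbf{d}=(d_1,\dots,d_n)$ be a graphical sequence. Then $\mathbf{d}$ admits a realization which is a $C_4$-pivotable graph if and only if $\sum_{i=1}^n d_i=4(n-1)-4$, $d_1<n-1$, and $d_n\ge 2$.
   Context: A degree sequence is non-increasing, $d_1\ge\dots\ge d_n\ge 0$; it is graphical if some simple graph on $v_1,\dots,v_n$ has $\deg(v_i)=d_i$ (a realization). A simple graph $G$ on $n$ vertices with exactly $2n-4$ edges is $C_4$-pivotable if $G$ contains an induced cycle $C$ of length 4 (the central cycle) and two spanning trees whose edge sets have exactly two common edges, both of which are edges of $C$. *)

theory Defs
  imports Main
begin

text \<open>
  Simple graphs are given by a vertex set and a set of two-element subsets of it. The notions of
  tree and forest for digraphs are not applicable: in a symmetric digraph every edge already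
  yields a directed cycle of length 2.
\<close>

definition simple_graph :: "'a set \<Rightarrow> 'a set set \<Rightarrow> bool" where
  "simple_graph V E \<longleftrightarrow> finite V \<and> (\<forall>e\<in>E. e \<subseteq> V \<and> card e = 2)"

definition degree :: "'a set set \<Rightarrow> 'a \<Rightarrow> nat" where
  "degree E v = card {e \<in> E. v \<in> e}"

definition connected_graph :: "'a set \<Rightarrow> 'a set set \<Rightarrow> bool" where
  "connected_graph V E \<longleftrightarrow>
     V \<noteq> {} \<and> (\<forall>u\<in>V. \<forall>v\<in>V. (\<lambda>x y. {x, y} \<in> E)\<^sup>*\<^sup>* u v)"

definition cycle_edges :: "'a list \<Rightarrow> 'a set set" where
  "cycle_edges C = {{C ! i, C ! (Suc i mod length C)} | i. i < length C}"

definition is_cycle :: "'a set set \<Rightarrow> 'a list \<Rightarrow> bool" where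
  "is_cycle E C \<longleftrightarrow> length C \<ge> 3 \<and> distinct C \<and> cycle_edges C \<subseteq> E"

definition induced_cycle :: "'a set set \<Rightarrow> 'a list \<Rightarrow> bool" where
  "induced_cycle E C \<longleftrightarrow> is_cycle E C \<and> (\<forall>e\<in>E. e \<subseteq> set C \<longrightarrow> e \<in> cycle_edges C)"

definition tree_graph :: "'a set \<Rightarrow> 'a set set \<Rightarrow> bool" where
  "tree_graph V T \<longleftrightarrow> simple_graph V T \<and> connected_graph V T \<and> (\<nexists>C. is_cycle T C)"

definition spanning_tree :: "'a set \<Rightarrow> 'a set set \<Rightarrow> 'a set set \<Rightarrow> bool" where
  "spanning_tree V E T \<longleftrightarrow> T \<subseteq> E \<and> tree_graph V T"

definition C4_pivotable :: "'a set \<Rightarrow> 'a set set \<Rightarrow> bool" where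
  "C4_pivotable V E \<longleftrightarrow>
     simple_graph V E \<and> int (card E) = 2 * int (card V) - 4 \<and>
     (\<exists>C T\<^sub>1 T\<^sub>2. induced_cycle E C \<and> length C = 4 \<and>
        spanning_tree V E T\<^sub>1 \<and> spanning_tree V E T\<^sub>2 \<and>
        card (T\<^sub>1 \<inter> T\<^sub>2) = 2 \<and> T\<^sub>1 \<inter> T\<^sub>2 \<subseteq> cycle_edges C)"

text \<open>
  A sequence \<open>d\<^sub>1, \<dots>, d\<^sub>n\<close> is a function on the naturals of which only the values on
  \<open>{1..n}\<close> matter; vertex \<open>v\<^sub>i\<close> is represented by \<open>i\<close>.
\<close>

definition degree_sequence :: "nat \<Rightarrow> (nat \<Rightarrow> nat) \<Rightarrow> bool" where
  "degree_sequence n d \<longleftrightarrow> antimono_on {1..n} d"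

definition realization :: "nat \<Rightarrow> (nat \<Rightarrow> nat) \<Rightarrow> nat set set \<Rightarrow> bool" where
  "realization n d E \<longleftrightarrow> simple_graph {1..n} E \<and> (\<forall>i\<in>{1..n}. degree E i = d i)"

definition graphical :: "nat \<Rightarrow> (nat \<Rightarrow> nat) \<Rightarrow> bool" where
  "graphical n d \<longleftrightarrow> degree_sequence n d \<and> (\<exists>E. realization n d E)"

end

theory Submission
  imports Defs
begin

text \<open>
  The two trees cover all edges, since \<open>2 (n - 1) - 2 = 2 n - 4\<close>; necessity of the degree bounds
  follows by counting tree edges.

  For sufficiency, induct on \<open>n\<close>, starting from the 4-cycle. The average degree is below 4, so
  the minimum degree is 2 or 3. A vertex \<open>v\<close> of degree 2 is removed while lowering the two largest
  degrees by one; conversely \<open>v\<close> is attached as a leaf to each tree. A vertex \<open>v\<close> of degree 3 is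
  removed while lowering the largest degree, of a vertex \<open>z\<close>, by one; conversely \<open>v\<close> subdivides
  in its tree an edge that avoids \<open>z\<close> and the central cycle, and is attached to \<open>z\<close> as a leaf of
  the other tree. Such an edge exists because minimum degree 3 forces \<open>n \<ge> 8\<close>. The degree bounds
  are preserved, for otherwise the degree sum would exceed \<open>4 n - 8\<close> or fall short of it.
\<close>

section \<open>Counting edges of connected graphs and forests\<close>

lemma reachable_sym:
  assumes "(\<lambda>x y. {x, y} \<in> E)\<^sup>*\<^sup>* u v"
  shows "(\<lambda>x y. {x, y} \<in> E)\<^sup>*\<^sup>* v u"
proof -
  have "symp (\<lambda>x y. {x, y} \<in> E)"
    by (auto intro!: sympI simp: insert_commute)
  then show ?thesis
    using assms by (meson symp_rtranclp sympD)
qed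

lemma connected_graphI:
  assumes "r \<in> V" and "\<And>v. v \<in> V \<Longrightarrow> (\<lambda>x y. {x, y} \<in> E)\<^sup>*\<^sup>* r v"
  shows "connected_graph V E"
proof -
  have "(\<lambda>x y. {x, y} \<in> E)\<^sup>*\<^sup>* u v" if "u \<in> V" "v \<in> V" for u v
    using reachable_sym[OF assms(2)[OF that(1)]] assms(2)[OF that(2)] by (rule rtranclp_trans)
  then show ?thesis using assms(1) by (auto simp: connected_graph_def)
qed

text \<open>Carries connectivity from \<open>E\<close> over to \<open>F\<close> once each edge of
  \<open>E\<close> is replaced by a walk in \<open>F\<close>. This covers deleting a cycle edge,
  adding a leaf and subdividing an edge.\<close>

lemma reachable_replace_edges:
  assumes "(\<lambda>x y. {x, y} \<in> E)\<^sup>*\<^sup>* u v"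
    and "\<And>x y. {x, y} \<in> E \<Longrightarrow> (\<lambda>x y. {x, y} \<in> F)\<^sup>*\<^sup>* x y"
  shows "(\<lambda>x y. {x, y} \<in> F)\<^sup>*\<^sup>* u v"
  using assms(1)
proof (induction rule: rtranclp_induct)
  case base
  show ?case by simp
next
  case (step y z)
  then show ?case using assms(2)[of y z] by simp
qed

lemma simple_graph_finite_edges:
  assumes "simple_graph V E"
  shows "finite E"
proof -
  have "E \<subseteq> Pow V" "finite V" using assms by (auto simp: simple_graph_def)
  then show ?thesis by (meson finite_Pow_iff finite_subset)
qed

lemma reachable_exits_set:
  assumes "(\<lambda>x y. {x, y} \<in> E)\<^sup>*\<^sup>* u v" "u \<in> S" "v \<notin> S"
  shows "\<exists>x y. {x, y} \<in> E \<and> x \<in> S \<and> y \<notin> S"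
  using assms by (induction rule: rtranclp_induct) blast+

text \<open>A vertex set grown from \<open>r\<close> can always be enlarged by the far end of an
  edge leaving it. That edge is not inside the earlier set, so each new vertex brings a new
  edge.\<close>

lemma connected_graph_card_le:
  assumes sg: "simple_graph V E" and con: "connected_graph V E"
  shows "card V \<le> card E + 1"
proof -
  have finE: "finite E" and finV: "finite V"
    using sg simple_graph_finite_edges by (auto simp: simple_graph_def)
  obtain r where r: "r \<in> V" using con by (auto simp: connected_graph_def)
  have grow: "\<exists>S. S \<subseteq> V \<and> r \<in> S \<and> card S = Suc k \<and> Suc k \<le> card {e \<in> E. e \<subseteq> S} + 1"
    if "Suc k \<le> card V" for k
    using that
  proof (induction k)
    case 0
    show ?case using r by (intro exI[of _ "{r}"]) auto
  next
    case (Suc k)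
    then obtain S where S: "S \<subseteq> V" "r \<in> S" "card S = Suc k"
      "Suc k \<le> card {e \<in> E. e \<subseteq> S} + 1"
      by auto
    have "S \<noteq> V" using S Suc.prems by auto
    then obtain w where w: "w \<in> V" "w \<notin> S" using S by auto
    have "(\<lambda>x y. {x, y} \<in> E)\<^sup>*\<^sup>* r w" using con r w by (auto simp: connected_graph_def)
    from reachable_exits_set[OF this \<open>r \<in> S\<close> \<open>w \<notin> S\<close>]
    obtain x y where xy: "{x, y} \<in> E" "x \<in> S" "y \<notin> S" by auto
    have "y \<in> V" using xy sg by (auto simp: simple_graph_def)
    have fS: "finite S" using S finV finite_subset by blast
    have "insert {x, y} {e \<in> E. e \<subseteq> S} \<subseteq> {e \<in> E. e \<subseteq> insert y S}"
      using xy by auto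
    then have "card (insert {x, y} {e \<in> E. e \<subseteq> S}) \<le> card {e \<in> E. e \<subseteq> insert y S}"
      using finE by (intro card_mono) auto
    moreover have "card (insert {x, y} {e \<in> E. e \<subseteq> S}) = Suc (card {e \<in> E. e \<subseteq> S})"
      using finE xy by (intro card_insert_disjoint) auto
    ultimately show ?case
      using S \<open>y \<in> V\<close> xy fS by (intro exI[of _ "insert y S"]) auto
  qed
  have "card V > 0" using r finV by (auto simp: card_gt_0_iff)
  then obtain S where S: "card S = card V" "card V \<le> card {e \<in> E. e \<subseteq> S} + 1"
    using grow[of "card V - 1"] by auto
  have "card {e \<in> E. e \<subseteq> S} \<le> card E" using finE by (intro card_mono) auto
  then show ?thesis using S by simp
qed

lemma reachable_distinct_path:
  assumes "P\<^sup>*\<^sup>* x y"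
  shows "\<exists>p. p \<noteq> [] \<and> hd p = x \<and> last p = y \<and> distinct p \<and> successively P p"
  using assms
proof (induction rule: converse_rtranclp_induct)
  case base
  show ?case by (intro exI[of _ "[y]"]) auto
next
  case (step x x')
  then obtain p where p: "p \<noteq> []" "hd p = x'" "last p = y" "distinct p" "successively P p"
    by auto
  show ?case
  proof (cases "x \<in> set p")
    case True
    \<comment> \<open>The new start already lies on the path, so the loop \<open>ys\<close> is cut
      off.\<close>
    then obtain ys zs where "p = ys @ x # zs" by (auto dest: split_list)
    then show ?thesis using p
      by (intro exI[of _ "x # zs"]) (auto simp: successively_append_iff)
  next
    case False
    then show ?thesis using p step.hyps
      by (intro exI[of _ "x # p"]) (auto simp: successively_Cons)
  qed
qed

text \<open>A path between the ends of an edge that avoids this edge closes with it to a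
  cycle.\<close>

lemma acyclic_edge_is_bridge:
  assumes acyc: "\<nexists>C. is_cycle E C" and e: "{x, y} \<in> E" and ne: "x \<noteq> y"
  shows "\<not> (\<lambda>u v. {u, v} \<in> E - {{x, y}})\<^sup>*\<^sup>* x y"
proof
  assume "(\<lambda>u v. {u, v} \<in> E - {{x, y}})\<^sup>*\<^sup>* x y"
  from reachable_distinct_path[OF this] obtain p where p: "p \<noteq> []" "hd p = x" "last p = y"
    "distinct p" "successively (\<lambda>u v. {u, v} \<in> E - {{x, y}}) p"
    by blast
  have step: "{p ! i, p ! Suc i} \<in> E - {{x, y}}" if "Suc i < length p" for i
    using p(5) that by (simp add: successively_conv_nth)
  have p0: "p ! 0 = x" and pl: "p ! (length p - 1) = y"
    using p by (auto simp: hd_conv_nth last_conv_nth)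
  have "length p \<noteq> 0" "length p \<noteq> 1" using p p0 pl ne by auto
  \<comment> \<open>With two vertices, the only step of the path would be the deleted edge
    itself.\<close>
  moreover have "length p \<noteq> 2" using step[of 0] p0 pl by auto
  ultimately have len: "length p \<ge> 3" by linarith
  have "{p ! i, p ! (Suc i mod length p)} \<in> E" if "i < length p" for i
  proof (cases "Suc i < length p")
    case True
    then show ?thesis using step[of i] by simp
  next
    case False
    then have "i = length p - 1" "Suc i = length p" using that by auto
    then show ?thesis using e p0 pl by (simp add: insert_commute)
  qed
  then have "is_cycle E p" using len p by (auto simp: is_cycle_def cycle_edges_def)
  then show False using acyc by blast
qed

lemma is_cycle_mono: "is_cycle F C \<Longrightarrow> F \<subseteq> E \<Longrightarrow> is_cycle E C"
  by (auto simp: is_cycle_def)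

text \<open>Deleting an edge of a forest leaves no edge between the component of one of its ends and
  the remaining vertices; the bound is then additive over the two sides.\<close>

lemma acyclic_card_edges_less:
  assumes "simple_graph V E" "\<nexists>C. is_cycle E C" "V \<noteq> {}"
  shows "card E < card V"
  using assms
proof (induction "card V" arbitrary: V E rule: less_induct)
  case less
  have finV: "finite V" using less.prems by (auto simp: simple_graph_def)
  have finE: "finite E" using less.prems simple_graph_finite_edges by blast
  show ?case
  proof (cases "E = {}")
    case True
    then show ?thesis using finV less.prems by (simp add: card_gt_0_iff)
  next
    case False
    then obtain e where e: "e \<in> E" by blast
    then have "card e = 2" using less.prems by (auto simp: simple_graph_def)
    then obtain x y where xy: "e = {x, y}" "x \<noteq> y" by (auto simp: card_2_iff)
    define A where "A = {v \<in> V. (\<lambda>u v. {u, v} \<in> E - {e})\<^sup>*\<^sup>* x v}"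
    have xyV: "x \<in> V" "y \<in> V" using e xy less.prems by (auto simp: simple_graph_def)
    have "x \<in> A" using xyV by (auto simp: A_def)
    have "y \<notin> A"
      using acyclic_edge_is_bridge[OF less.prems(2), of x y] e xy by (auto simp: A_def)
    have AV: "A \<subseteq> V" by (auto simp: A_def)
    have fA: "finite A" and fB: "finite (V - A)" using AV finV finite_subset by auto
    have split: "E - {e} = {f \<in> E - {e}. f \<subseteq> A} \<union> {f \<in> E - {e}. f \<subseteq> V - A}"
    proof -
      have "f \<subseteq> A \<or> f \<subseteq> V - A" if f: "f \<in> E - {e}" for f
      proof -
        have "card f = 2" "f \<subseteq> V" using f less.prems by (auto simp: simple_graph_def)
        then obtain a b where ab: "f = {a, b}" "a \<in> V" "b \<in> V" by (auto simp: card_2_iff)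
        have "{a, b} \<in> E - {e}" "{b, a} \<in> E - {e}"
          using f ab by (auto simp: insert_commute)
        then have "a \<in> A \<longleftrightarrow> b \<in> A"
          using ab unfolding A_def
          by (smt (verit, best) mem_Collect_eq rtranclp.rtrancl_into_rtrancl)
        then show ?thesis using ab by auto
      qed
      then show ?thesis by blast
    qed
    have less_side: "card {f \<in> E - {e}. f \<subseteq> B} < card B"
      if "B \<subseteq> V" "B \<noteq> V" "B \<noteq> {}" for B
    proof (rule less.hyps)
      show "card B < card V" using that finV by (simp add: psubset_card_mono psubsetI)
      show "simple_graph B {f \<in> E - {e}. f \<subseteq> B}"
        using that less.prems finite_subset by (auto simp: simple_graph_def)
      show "\<nexists>C. is_cycle {f \<in> E - {e}. f \<subseteq> B} C"
        using less.prems(2) is_cycle_mono[of "{f \<in> E - {e}. f \<subseteq> B}" _ E] by blast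
      show "B \<noteq> {}" by fact
    qed
    have "card (E - {e}) \<le> card {f \<in> E - {e}. f \<subseteq> A} + card {f \<in> E - {e}. f \<subseteq> V - A}"
      by (subst split) (rule card_Un_le)
    moreover have "card {f \<in> E - {e}. f \<subseteq> A} < card A"
      using less_side[of A] AV \<open>x \<in> A\<close> \<open>y \<notin> A\<close> xyV by blast
    moreover have "card {f \<in> E - {e}. f \<subseteq> V - A} < card (V - A)"
      using less_side[of "V - A"] AV \<open>x \<in> A\<close> \<open>y \<notin> A\<close> xyV by blast
    moreover have "card A + card (V - A) = card V"
      using AV fA finV by (simp add: card_Diff_subset card_mono)
    moreover have "card E = Suc (card (E - {e}))"
      using card.remove[OF finE e] by simp
    ultimately show ?thesis by linarith
  qed
qed

text \<open>The rest of the cycle, walked from \<open>C ! 1\<close> around to \<open>C ! 0\<close>,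
  is a detour for the deleted edge.\<close>

lemma connected_remove_cycle_edge:
  assumes con: "connected_graph V E" and C: "is_cycle E C"
  shows "connected_graph V (E - {{C ! 0, C ! 1}})"
proof -
  let ?F = "E - {{C ! 0, C ! 1}}"
  have len: "length C \<ge> 3" and dist: "distinct C" and CE: "cycle_edges C \<subseteq> E"
    using C by (auto simp: is_cycle_def)
  have pos: "0 < length C" "1 < length C" using len by linarith+
  have E: "{C ! i, C ! (Suc i mod length C)} \<in> E" if "i < length C" for i
    using CE that by (auto simp: cycle_edges_def)
  have nth_eq: "C ! i = C ! j \<longleftrightarrow> i = j" if "i < length C" "j < length C" for i j
    using dist that by (simp add: nth_eq_iff_index_eq)
  have reach: "(\<lambda>x y. {x, y} \<in> ?F)\<^sup>*\<^sup>* (C ! 1) (C ! Suc i)" if "Suc i < length C" for i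
    using that
  proof (induction i)
    case 0
    show ?case by simp
  next
    case (Suc i)
    have "{C ! Suc i, C ! Suc (Suc i)} \<in> E" using E[of "Suc i"] Suc.prems by simp
    moreover have "C ! Suc (Suc i) \<noteq> C ! 0" "C ! Suc (Suc i) \<noteq> C ! 1"
      using nth_eq[OF Suc.prems pos(1)] nth_eq[OF Suc.prems pos(2)] by auto
    ultimately have "{C ! Suc i, C ! Suc (Suc i)} \<in> ?F" by (auto simp: doubleton_eq_iff)
    then show ?case using Suc by (simp add: rtranclp.rtrancl_into_rtrancl)
  qed
  \<comment> \<open>The walk ends with the edge from the last vertex back to \<open>C ! 0\<close>;
    it differs from the deleted edge because the cycle has at least three vertices.\<close>
  let ?l = "length C - 1"
  have l: "Suc ?l mod length C = 0" "?l < length C" using pos(1) by auto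
  then have "{C ! ?l, C ! 0} \<in> E" using E[of ?l] by simp
  moreover have "C ! ?l \<noteq> C ! 0" "C ! ?l \<noteq> C ! 1"
    using len nth_eq[OF l(2) pos(1)] nth_eq[OF l(2) pos(2)] by auto
  ultimately have "{C ! ?l, C ! 0} \<in> ?F" by (auto simp: doubleton_eq_iff)
  moreover have "(\<lambda>x y. {x, y} \<in> ?F)\<^sup>*\<^sup>* (C ! 1) (C ! ?l)"
    using reach[of "?l - 1"] len by (simp add: Suc_diff_Suc numeral_3_eq_3)
  ultimately have r10: "(\<lambda>x y. {x, y} \<in> ?F)\<^sup>*\<^sup>* (C ! 1) (C ! 0)"
    by (simp add: rtranclp.rtrancl_into_rtrancl)
  have "(\<lambda>x y. {x, y} \<in> ?F)\<^sup>*\<^sup>* x y" if "{x, y} \<in> E" for x y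
  proof (cases "{x, y} = {C ! 0, C ! 1}")
    case True
    then show ?thesis using r10 reachable_sym[OF r10] by (auto simp: doubleton_eq_iff)
  next
    case False
    then show ?thesis using that by auto
  qed
  then show ?thesis
    using con reachable_replace_edges[of E _ _ ?F] by (simp add: connected_graph_def)
qed

section \<open>Trees: counting characterization and extension by one vertex\<close>

text \<open>With this form, modifying a tree requires checking only connectivity and the number of
  edges, never cycles. For the converse, deleting an edge of a cycle would leave a connected graph
  with too few edges.\<close>

lemma tree_graph_iff_card:
  "tree_graph V T \<longleftrightarrow> simple_graph V T \<and> connected_graph V T \<and> card T + 1 = card V"
proof
  assume "tree_graph V T"
  then have T: "simple_graph V T" "connected_graph V T" "\<nexists>C. is_cycle T C"
    by (auto simp: tree_graph_def)
  then have "V \<noteq> {}" by (auto simp: connected_graph_def)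
  then show "simple_graph V T \<and> connected_graph V T \<and> card T + 1 = card V"
    using T acyclic_card_edges_less[of V T] connected_graph_card_le[of V T] by auto
next
  assume T: "simple_graph V T \<and> connected_graph V T \<and> card T + 1 = card V"
  have "\<not> is_cycle T C" for C
  proof
    assume C: "is_cycle T C"
    let ?F = "T - {{C ! 0, C ! 1}}"
    have "length C \<ge> 3" using C by (auto simp: is_cycle_def)
    then have "{C ! 0, C ! 1} \<in> cycle_edges C"
      by (auto simp: cycle_edges_def intro!: exI[of _ 0])
    then have "{C ! 0, C ! 1} \<in> T" using C by (auto simp: is_cycle_def)
    then have "card ?F < card T"
      using T simple_graph_finite_edges by (metis card_Diff1_less)
    moreover have "simple_graph V ?F" using T by (auto simp: simple_graph_def)
    then have "card V \<le> card ?F + 1"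
      using connected_graph_card_le connected_remove_cycle_edge[OF _ C] T by blast
    ultimately show False using T by simp
  qed
  then show "tree_graph V T" using T by (auto simp: tree_graph_def)
qed

lemma tree_graph_add_leaf:
  assumes T: "tree_graph V T" and a: "a \<in> V" and v: "v \<notin> V"
  shows "tree_graph (insert v V) (insert {v, a} T)"
proof -
  have T': "simple_graph V T" "connected_graph V T" "card T + 1 = card V"
    using T by (auto simp: tree_graph_iff_card)
  have fin: "finite T" "finite V" using T' simple_graph_finite_edges by (auto simp: simple_graph_def)
  have new: "{v, a} \<notin> T" using T' v by (auto simp: simple_graph_def)
  have "connected_graph (insert v V) (insert {v, a} T)"
  proof (rule connected_graphI[of a])
    fix u assume u: "u \<in> insert v V"
    show "(\<lambda>x y. {x, y} \<in> insert {v, a} T)\<^sup>*\<^sup>* a u"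
    proof (cases "u = v")
      case True
      then show ?thesis by (intro r_into_rtranclp) (auto simp: insert_commute)
    next
      case False
      then have "(\<lambda>x y. {x, y} \<in> T)\<^sup>*\<^sup>* a u" using u a T' by (auto simp: connected_graph_def)
      then show ?thesis by (rule reachable_replace_edges) auto
    qed
  qed (use a in auto)
  moreover have "simple_graph (insert v V) (insert {v, a} T)"
    using T' a v by (auto simp: simple_graph_def card_2_iff)
  ultimately show ?thesis
    using T' fin new v by (auto simp: tree_graph_iff_card)
qed

text \<open>The path \<open>x\<close>, \<open>v\<close>, \<open>y\<close> stands in for the removed
  edge, and vertices and edges both increase by one.\<close>

lemma tree_graph_subdivide_edge:
  assumes T: "tree_graph V T" and e: "{x, y} \<in> T" and v: "v \<notin> V"
  shows "tree_graph (insert v V) (insert {v, x} (insert {v, y} (T - {{x, y}})))"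
    (is "tree_graph _ ?F")
proof -
  have T': "simple_graph V T" "connected_graph V T" "card T + 1 = card V"
    using T by (auto simp: tree_graph_iff_card)
  have fin: "finite T" "finite V" using T' simple_graph_finite_edges by (auto simp: simple_graph_def)
  have xy: "x \<in> V" "y \<in> V" "x \<noteq> y" using T' e by (auto simp: simple_graph_def)
  have new: "{v, x} \<notin> T" "{v, y} \<notin> T" "{v, x} \<noteq> {v, y}"
    using T' v xy by (auto simp: simple_graph_def doubleton_eq_iff)
  have rxv: "(\<lambda>x y. {x, y} \<in> ?F)\<^sup>*\<^sup>* x v" and rvy: "(\<lambda>x y. {x, y} \<in> ?F)\<^sup>*\<^sup>* v y"
    by (intro r_into_rtranclp; auto simp: insert_commute)+
  have rxy: "(\<lambda>x y. {x, y} \<in> ?F)\<^sup>*\<^sup>* x y" using rxv rvy by (rule rtranclp_trans)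
  have old: "(\<lambda>x y. {x, y} \<in> ?F)\<^sup>*\<^sup>* a b" if "{a, b} \<in> T" for a b
  proof (cases "{a, b} = {x, y}")
    case True
    then show ?thesis using rxy reachable_sym[OF rxy] by (auto simp: doubleton_eq_iff)
  next
    case False
    then show ?thesis using that by (intro r_into_rtranclp) auto
  qed
  have "connected_graph (insert v V) ?F"
  proof (rule connected_graphI[of x])
    fix u assume u: "u \<in> insert v V"
    show "(\<lambda>x y. {x, y} \<in> ?F)\<^sup>*\<^sup>* x u"
    proof (cases "u = v")
      case True
      then show ?thesis using rxv by simp
    next
      case False
      then have "(\<lambda>x y. {x, y} \<in> T)\<^sup>*\<^sup>* x u" using u xy T' by (auto simp: connected_graph_def)
      then show ?thesis by (rule reachable_replace_edges) (rule old)
    qed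
  qed (use xy in auto)
  moreover have "simple_graph (insert v V) ?F"
    using T' xy v by (auto simp: simple_graph_def card_2_iff)
  moreover have "card ?F = Suc (card T)"
  proof -
    have "card T > 0" using e fin by (auto simp: card_gt_0_iff)
    then show ?thesis using new e fin by simp
  qed
  ultimately show ?thesis
    using T' fin v by (auto simp: tree_graph_iff_card)
qed

lemma tree_graph_degree_pos:
  assumes T: "tree_graph V T" and v: "v \<in> V" and card: "card V \<ge> 2"
  shows "\<exists>e\<in>T. v \<in> e"
proof -
  have "V \<noteq> {v}" using card by auto
  then obtain w where "w \<in> V" "w \<noteq> v" using v by auto
  moreover have "(\<lambda>x y. {x, y} \<in> T)\<^sup>*\<^sup>* v w"
    using T v \<open>w \<in> V\<close> by (auto simp: tree_graph_def connected_graph_def)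
  ultimately show ?thesis using reachable_exits_set[of T v w "{v}"] by blast
qed

text \<open>Handshake lemma, by counting incidences from both sides.\<close>

lemma sum_degree:
  assumes "simple_graph V E"
  shows "(\<Sum>v\<in>V. degree E v) = 2 * card E"
  unfolding degree_def
proof (rule sum_multicount)
  show "finite V" "finite E"
    using assms simple_graph_finite_edges by (auto simp: simple_graph_def)
  show "\<forall>e\<in>E. card {v \<in> V. v \<in> e} = 2"
  proof
    fix e assume "e \<in> E"
    then have "{v \<in> V. v \<in> e} = e" "card e = 2" using assms by (auto simp: simple_graph_def)
    then show "card {v \<in> V. v \<in> e} = 2" by simp
  qed
qed

section \<open>Pivotable graphs\<close>

lemma cycle_edges_4:
  "cycle_edges [a, b, c, d] = {{a, b}, {b, c}, {c, d}, {d, a}}"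
proof -
  let ?C = "[a, b, c, d]"
  have "cycle_edges ?C = (\<lambda>i. {?C ! i, ?C ! (Suc i mod length ?C)}) ` {..<4}"
    by (auto simp: cycle_edges_def)
  also have "{..<4::nat} = {0, Suc 0, Suc (Suc 0), Suc (Suc (Suc 0))}" by auto
  finally show ?thesis by simp
qed

lemma length_4_cases:
  assumes "length C = 4"
  obtains a b c d where "C = [a, b, c, d]"
  using assms by (auto simp: numeral_eq_Suc length_Suc_conv)

lemma cycle_vertices_subset:
  assumes "simple_graph V E" "is_cycle E C"
  shows "set C \<subseteq> V"
proof
  fix x assume "x \<in> set C"
  then obtain i where i: "i < length C" "x = C ! i" by (auto simp: in_set_conv_nth)
  then have "{C ! i, C ! (Suc i mod length C)} \<in> E"
    using assms by (auto simp: is_cycle_def cycle_edges_def)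
  then show "x \<in> V" using assms i by (auto simp: simple_graph_def)
qed

text \<open>An edge through \<open>v\<close> cannot lie inside \<open>set C\<close>, so no chord
  arises. \<open>E'\<close> need only keep the edges of the cycle, since subdividing removes another
  edge of \<open>E\<close>.\<close>

lemma induced_cycle_add_vertex:
  assumes "induced_cycle E C" "v \<notin> set C" "cycle_edges C \<subseteq> E'" "\<And>e. e \<in> E' \<Longrightarrow> e \<in> E \<or> v \<in> e"
  shows "induced_cycle E' C"
  using assms unfolding induced_cycle_def is_cycle_def by blast

lemma spanning_trees_cover:
  assumes E: "simple_graph V E" and card: "int (card E) = 2 * int (card V) - 4"
    and T: "spanning_tree V E T\<^sub>1" "spanning_tree V E T\<^sub>2" and int2: "card (T\<^sub>1 \<inter> T\<^sub>2) = 2"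
  shows "E = T\<^sub>1 \<union> T\<^sub>2"
proof -
  have finE: "finite E" using E by (rule simple_graph_finite_edges)
  have sub: "T\<^sub>1 \<subseteq> E" "T\<^sub>2 \<subseteq> E" and cT: "card T\<^sub>1 + 1 = card V" "card T\<^sub>2 + 1 = card V"
    using T by (auto simp: spanning_tree_def tree_graph_iff_card)
  have "card T\<^sub>1 + card T\<^sub>2 = card (T\<^sub>1 \<union> T\<^sub>2) + card (T\<^sub>1 \<inter> T\<^sub>2)"
    using sub finE by (intro card_Un_Int) (auto dest: finite_subset)
  then have "card (T\<^sub>1 \<union> T\<^sub>2) = card E" using cT card int2 by linarith
  then show ?thesis using sub finE by (metis card_subset_eq le_sup_iff)
qed

lemma C4_pivotableE:
  assumes "C4_pivotable V E"
  obtains a b c d T\<^sub>1 T\<^sub>2 where "simple_graph V E" "int (card E) = 2 * int (card V) - 4"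
    "induced_cycle E [a, b, c, d]" "distinct [a, b, c, d]" "{a, b, c, d} \<subseteq> V"
    "spanning_tree V E T\<^sub>1" "spanning_tree V E T\<^sub>2"
    "card (T\<^sub>1 \<inter> T\<^sub>2) = 2" "T\<^sub>1 \<inter> T\<^sub>2 \<subseteq> cycle_edges [a, b, c, d]" "E = T\<^sub>1 \<union> T\<^sub>2"
proof -
  from assms obtain C T\<^sub>1 T\<^sub>2 where *: "simple_graph V E" "int (card E) = 2 * int (card V) - 4"
    "induced_cycle E C" "length C = 4" "spanning_tree V E T\<^sub>1" "spanning_tree V E T\<^sub>2"
    "card (T\<^sub>1 \<inter> T\<^sub>2) = 2" "T\<^sub>1 \<inter> T\<^sub>2 \<subseteq> cycle_edges C"
    unfolding C4_pivotable_def by blast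
  obtain a b c d where C: "C = [a, b, c, d]" using *(4) by (rule length_4_cases)
  have "is_cycle E C" using * by (auto simp: induced_cycle_def)
  then have "distinct C" "set C \<subseteq> V"
    using cycle_vertices_subset[OF *(1)] by (simp_all add: is_cycle_def)
  moreover have "E = T\<^sub>1 \<union> T\<^sub>2" using * spanning_trees_cover by blast
  ultimately show ?thesis
    using that[of a b c d T\<^sub>1 T\<^sub>2] *(1-3,5-8) unfolding C by simp
qed

text \<open>The common edge set is a separate parameter \<open>I\<close>, so that after an extension
  the intersection of the old trees can be supplied for it.\<close>

lemma C4_pivotableI:
  assumes "simple_graph V E" "int (card E) = 2 * int (card V) - 4"
    "spanning_tree V E T\<^sub>1" "spanning_tree V E T\<^sub>2" "induced_cycle E C"
    "T\<^sub>1 \<inter> T\<^sub>2 = I" "card I = 2" "I \<subseteq> cycle_edges C" "length C = 4"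
  shows "C4_pivotable V E"
  using assms unfolding C4_pivotable_def by blast

section \<open>Necessity of the degree bounds\<close>

lemma degree_ge_2I:
  assumes "finite E" "e \<in> E" "f \<in> E" "v \<in> e" "v \<in> f" "e \<noteq> f"
  shows "degree E v \<ge> 2"
proof -
  have "card {e, f} \<le> degree E v"
    unfolding degree_def using assms by (intro card_mono) auto
  then show ?thesis using assms by simp
qed

text \<open>A pendant edge would lie in both trees, hence on the central cycle, whose vertices have
  degree at least 2.\<close>

lemma C4_pivotable_min_degree:
  assumes "C4_pivotable V E" and v: "v \<in> V"
  shows "degree E v \<ge> 2"
  using assms(1)
proof (cases rule: C4_pivotableE)
  case (1 a b c d T1 T2)
  have finE: "finite E" and finV: "finite V"
    using 1(1) simple_graph_finite_edges by (auto simp: simple_graph_def)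
  have "card {a, b, c, d} \<le> card V" using 1(5) finV by (intro card_mono)
  then have card: "card V \<ge> 2" using 1(4) by simp
  have trees: "tree_graph V T1" "tree_graph V T2" using 1 by (auto simp: spanning_tree_def)
  obtain e f where ef: "e \<in> T1" "v \<in> e" "f \<in> T2" "v \<in> f"
    using tree_graph_degree_pos[OF trees(1) v card] tree_graph_degree_pos[OF trees(2) v card] by auto
  show ?thesis
  proof (cases "e = f")
    case False
    then show ?thesis using degree_ge_2I[OF finE, of e f v] ef 1(10) by auto
  next
    case True
    then have "e \<in> cycle_edges [a, b, c, d]" using ef 1(9) by auto
    then have "v \<in> {a, b, c, d}" using ef by (auto simp: cycle_edges_4)
    moreover have "{a, b} \<in> E" "{b, c} \<in> E" "{c, d} \<in> E" "{d, a} \<in> E"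
      using 1(3) by (auto simp: induced_cycle_def is_cycle_def cycle_edges_4)
    moreover have "{a, b} \<noteq> {b, c}" "{b, c} \<noteq> {c, d}" "{c, d} \<noteq> {d, a}" "{d, a} \<noteq> {a, b}"
      using 1(4) by (auto simp: doubleton_eq_iff)
    ultimately show ?thesis
      using degree_ge_2I[OF finE, of "{a, b}" "{b, c}" v] degree_ge_2I[OF finE, of "{b, c}" "{c, d}" v]
        degree_ge_2I[OF finE, of "{c, d}" "{d, a}" v] degree_ge_2I[OF finE, of "{d, a}" "{a, b}" v]
      by auto
  qed
qed

text \<open>The edges at \<open>v\<close> are among the \<open>card V - 1\<close> pairs joining
  \<open>v\<close> to another vertex; having at least that many, they are all of these
  pairs.\<close>

lemma dominating_vertex_adjacent:
  assumes E: "simple_graph V E" and v: "v \<in> V" and deg: "degree E v + 1 \<ge> card V"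
    and w: "w \<in> V" "w \<noteq> v"
  shows "{v, w} \<in> E"
proof -
  let ?N = "(\<lambda>w. {v, w}) ` (V - {v})"
  have finV: "finite V" using E by (auto simp: simple_graph_def)
  have sub: "{e \<in> E. v \<in> e} \<subseteq> ?N"
  proof
    fix e assume e: "e \<in> {e \<in> E. v \<in> e}"
    then have "card e = 2" "e \<subseteq> V" using E by (auto simp: simple_graph_def)
    then obtain x y where "e = {x, y}" "x \<noteq> y" "x \<in> V" "y \<in> V" by (auto simp: card_2_iff)
    then show "e \<in> ?N" using e by auto
  qed
  have "card ?N \<le> card (V - {v})" using finV by (intro card_image_le) auto
  also have "\<dots> \<le> card {e \<in> E. v \<in> e}" using deg v finV by (simp add: degree_def)
  finally have "{e \<in> E. v \<in> e} = ?N" using sub finV by (intro card_seteq) auto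
  then show ?thesis using w by blast
qed

text \<open>A vertex adjacent to all others is off the induced cycle and spans a wheel with it. The
  wheel has 8 edges on 5 vertices, but the trees cover at most \<open>4 + 4 - 2\<close> of them.\<close>

lemma C4_pivotable_max_degree:
  assumes "C4_pivotable V E" and v: "v \<in> V"
  shows "degree E v + 1 < card V"
  using assms(1)
proof (cases rule: C4_pivotableE)
  case (1 a b c d T1 T2)
  show ?thesis
  proof (rule ccontr)
    assume "\<not> ?thesis"
    then have adj: "{v, w} \<in> E" if "w \<in> V" "w \<noteq> v" for w
      using dominating_vertex_adjacent[OF 1(1) v] that by simp
    have ind: "e \<in> {{a, b}, {b, c}, {c, d}, {d, a}}" if "e \<in> E" "e \<subseteq> {a, b, c, d}" for e
      using 1(3) that by (auto simp: induced_cycle_def cycle_edges_4)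
    \<comment> \<open>On the cycle, \<open>v\<close> would be joined to the opposite vertex by a
      chord.\<close>
    have notin: "v \<notin> {a, b, c, d}"
      using 1(4,5) ind[OF adj[of a]] ind[OF adj[of b]] ind[OF adj[of c]] ind[OF adj[of d]]
      by (auto simp: doubleton_eq_iff)
    define S where "S = {v, a, b, c, d}"
    define F where "F = {{a, b}, {b, c}, {c, d}, {d, a}, {v, a}, {v, b}, {v, c}, {v, d}}"
    have "card S = 5" using 1(4) notin by (auto simp: S_def)
    have "card F = 8" using 1(4) notin by (auto simp: F_def doubleton_eq_iff)
    have "finite F" by (auto simp: F_def)
    have FE: "F \<subseteq> E"
      using 1(3,5) adj notin
      by (auto simp: F_def induced_cycle_def is_cycle_def cycle_edges_4)
    have bound: "card (F \<inter> T) \<le> 4" if "spanning_tree V E T" for T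
    proof -
      have "simple_graph S (F \<inter> T)"
        using FE 1(1) by (auto simp: simple_graph_def S_def F_def)
      moreover have "\<nexists>C. is_cycle (F \<inter> T) C"
        using that is_cycle_mono[of "F \<inter> T" _ T] by (auto simp: spanning_tree_def tree_graph_def)
      ultimately have "card (F \<inter> T) < card S"
        by (rule acyclic_card_edges_less) (simp add: S_def)
      then show ?thesis using \<open>card S = 5\<close> by simp
    qed
    \<comment> \<open>The common edges lie on the rim, so restricting to the wheel keeps both of
      them. The two restricted trees then have 8 + 2 = 10 edges in total, more than 4 + 4.\<close>
    have "cycle_edges [a, b, c, d] \<subseteq> F" by (simp add: cycle_edges_4 F_def)
    then have "T1 \<inter> T2 \<subseteq> F" using 1(9) by (rule order_trans[rotated])
    then have "(F \<inter> T1) \<inter> (F \<inter> T2) = T1 \<inter> T2" by blast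
    moreover have "(F \<inter> T1) \<union> (F \<inter> T2) = F" using FE 1(10) by blast
    moreover have "card (F \<inter> T1) + card (F \<inter> T2)
        = card ((F \<inter> T1) \<union> (F \<inter> T2)) + card ((F \<inter> T1) \<inter> (F \<inter> T2))"
      using \<open>finite F\<close> by (intro card_Un_Int) auto
    ultimately show False using bound[OF 1(6)] bound[OF 1(7)] 1(8) \<open>card F = 8\<close> by simp
  qed
qed

section \<open>Adding a vertex of degree 2 or 3\<close>

text \<open>The two new edges go to different trees, so the common edges stay the same, and two more
  edges for one more vertex fit the count \<open>2 n - 4\<close>.\<close>

lemma C4_pivotable_add_degree_2:
  assumes "C4_pivotable V E" and ab: "a \<in> V" "b \<in> V" "a \<noteq> b" and v: "v \<notin> V"
  shows "C4_pivotable (insert v V) (insert {v, a} (insert {v, b} E))" (is "C4_pivotable ?V ?E")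
  using assms(1)
proof (cases rule: C4_pivotableE)
  case (1 p q r s T1 T2)
  let ?C = "[p, q, r, s]"
  have fin: "finite E" "finite V"
    using 1(1) simple_graph_finite_edges by (auto simp: simple_graph_def)
  have new: "{v, a} \<notin> E" "{v, b} \<notin> E" "{v, a} \<noteq> {v, b}"
    using 1(1) v ab by (auto simp: simple_graph_def doubleton_eq_iff)
  have "simple_graph ?V ?E" using 1(1) v ab by (auto simp: simple_graph_def card_2_iff)
  moreover have "int (card ?E) = 2 * int (card ?V) - 4" using 1(2) new fin v by simp
  moreover have "spanning_tree ?V ?E (insert {v, a} T1)" "spanning_tree ?V ?E (insert {v, b} T2)"
    using 1(6,7) tree_graph_add_leaf v ab by (auto simp: spanning_tree_def)
  moreover have "induced_cycle ?E ?C"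
    by (rule induced_cycle_add_vertex[OF 1(3), where v = v])
      (use 1(3,5) v in \<open>auto simp: induced_cycle_def is_cycle_def\<close>)
  moreover have "insert {v, a} T1 \<inter> insert {v, b} T2 = T1 \<inter> T2"
    using new 1(10) by auto
  ultimately show ?thesis using 1(8,9) by (rule C4_pivotableI) simp
qed

text \<open>By \<open>deg\<close>, the edges at \<open>z\<close> and the four cycle edges do not
  exhaust \<open>E\<close>; any remaining edge can be subdivided. Avoiding \<open>z\<close> keeps
  the three edges at \<open>v\<close> distinct.\<close>

lemma C4_pivotable_add_degree_3:
  assumes "C4_pivotable V E" and z: "z \<in> V" and v: "v \<notin> V" and deg: "degree E z + 4 < card E"
  shows "\<exists>x y. {x, y} \<in> E \<and> x \<noteq> y \<and> z \<notin> {x, y} \<and>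
    C4_pivotable (insert v V) (insert {v, z} (insert {v, x} (insert {v, y} (E - {{x, y}}))))"
  using assms(1)
proof (cases rule: C4_pivotableE)
  case (1 p q r s T1 T2)
  let ?C = "[p, q, r, s]"
  let ?V = "insert v V"
  have fin: "finite E" "finite V"
    using 1(1) simple_graph_finite_edges by (auto simp: simple_graph_def)
  have "card (cycle_edges ?C) \<le> 4" by (simp add: cycle_edges_4 card_insert_if)
  moreover have "card (cycle_edges ?C \<union> {e \<in> E. z \<in> e}) \<le> card (cycle_edges ?C) + degree E z"
    unfolding degree_def by (rule card_Un_le)
  ultimately have "card (cycle_edges ?C \<union> {e \<in> E. z \<in> e}) < card E" using deg by linarith
  then have "\<not> E \<subseteq> cycle_edges ?C \<union> {e \<in> E. z \<in> e}"
    using fin card_mono[of "cycle_edges ?C \<union> {e \<in> E. z \<in> e}" E] by (auto simp: cycle_edges_4)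
  then obtain e where e: "e \<in> E" "e \<notin> cycle_edges ?C" "z \<notin> e" by blast
  then have "card e = 2" "e \<subseteq> V" using 1(1) by (auto simp: simple_graph_def)
  then obtain x y where xy: "e = {x, y}" "x \<noteq> y" "x \<in> V" "y \<in> V" by (auto simp: card_2_iff)
  let ?E = "insert {v, z} (insert {v, x} (insert {v, y} (E - {{x, y}})))"
  have zxy: "z \<noteq> x" "z \<noteq> y" using e xy by auto
  have new: "{v, w} \<notin> E" for w using 1(1) v by (auto simp: simple_graph_def)
  have new2: "{v, x} \<noteq> {v, y}" "{v, z} \<noteq> {v, x}" "{v, z} \<noteq> {v, y}"
    using xy zxy by (auto simp: doubleton_eq_iff)
  have simple: "simple_graph ?V ?E"
    using 1(1) v xy z by (auto simp: simple_graph_def card_2_iff)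
  have "card E > 0" using e fin by (auto simp: card_gt_0_iff)
  then have card: "int (card ?E) = 2 * int (card ?V) - 4"
    using 1(2) new new2 fin v e xy by simp
  have cyc: "induced_cycle ?E ?C"
    by (rule induced_cycle_add_vertex[OF 1(3), where v = v])
      (use 1(3,5) v e xy in \<open>auto simp: induced_cycle_def is_cycle_def\<close>)
  \<comment> \<open>Stated for arbitrary \<open>T\<close> and \<open>T'\<close> because the chosen
    edge may belong to either of the two trees.\<close>
  have "C4_pivotable ?V ?E"
    if T: "spanning_tree V E T" and T': "spanning_tree V E T'" and eT: "e \<in> T"
      and int: "T \<inter> T' = T1 \<inter> T2" for T T'
  proof -
    let ?T = "insert {v, x} (insert {v, y} (T - {{x, y}}))"
    let ?T' = "insert {v, z} T'"
    \<comment> \<open>Common edges lie on the cycle and \<open>e\<close> does not, so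
      \<open>T'\<close> survives the deletion of \<open>e\<close>.\<close>
    have "e \<notin> T'" using int eT e 1(9) by blast
    then have trees: "spanning_tree ?V ?E ?T" "spanning_tree ?V ?E ?T'"
      using T T' tree_graph_subdivide_edge[of V T x y v] tree_graph_add_leaf[of V T' z v] eT v xy z
      by (auto simp: spanning_tree_def)
    have "?T \<inter> ?T' = T1 \<inter> T2"
    proof -
      have notT: "{v, w} \<notin> T" "{v, w} \<notin> T'" for w
        using new[of w] T T' by (auto simp: spanning_tree_def)
      have "?T \<inter> ?T' = T \<inter> T'"
        using notT new2 \<open>e \<notin> T'\<close> xy(1) by blast
      then show ?thesis using int by (rule trans)
    qed
    then show ?thesis
      by (rule C4_pivotableI[OF simple card trees cyc _ 1(8,9)]) simp
  qed
  then have "C4_pivotable ?V ?E"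
    using 1(6,7,10) e(1) by (metis Int_commute UnE)
  then show ?thesis using e xy by blast
qed

section \<open>Constructing a realization\<close>

lemma degree_insert:
  assumes "finite E" "e \<notin> E"
  shows "degree (insert e E) u = degree E u + (if u \<in> e then 1 else 0)"
proof (cases "u \<in> e")
  case True
  then have "{f \<in> insert e E. u \<in> f} = insert e {f \<in> E. u \<in> f}" by auto
  then show ?thesis using assms True by (simp add: degree_def)
next
  case False
  then have "{f \<in> insert e E. u \<in> f} = {f \<in> E. u \<in> f}" by auto
  then show ?thesis using False by (simp add: degree_def)
qed

lemma degree_remove:
  assumes "finite E" "e \<in> E"
  shows "degree E u = degree (E - {e}) u + (if u \<in> e then 1 else 0)"
  using degree_insert[of "E - {e}" e u] assms by (simp add: insert_absorb)

lemma degree_notin_vertices: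
  assumes "simple_graph V E" "v \<notin> V"
  shows "degree E v = 0"
proof -
  have "{e \<in> E. v \<in> e} = {}" using assms by (auto simp: simple_graph_def)
  then show ?thesis unfolding degree_def by (simp only: card.empty)
qed

lemma ex_maximizer:
  fixes f :: "'a \<Rightarrow> nat"
  assumes "finite A" "A \<noteq> {}"
  shows "\<exists>a\<in>A. \<forall>x\<in>A. f x \<le> f a"
proof -
  have "Max (f ` A) \<in> f ` A" using assms by (intro Max_in) auto
  then obtain a where "a \<in> A" "f a = Max (f ` A)" by auto
  then show ?thesis using assms by (intro bexI[of _ a]) auto
qed

text \<open>With \<open>A\<close> empty this bounds the number of vertices; with \<open>A\<close> a
  set of vertices of large degree it shows that there cannot be too many of them.\<close>

lemma sum_ge_card:
  fixes d :: "'a \<Rightarrow> nat"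
  assumes "finite V" "A \<subseteq> V" "\<And>v. v \<in> V \<Longrightarrow> k \<le> d v"
  shows "sum d A + k * (card V - card A) \<le> sum d V"
proof -
  have "card (V - A) * k \<le> sum d (V - A)"
    using assms sum_bounded_below[of "V - A" k d] by auto
  moreover have "sum d V = sum d (V - A) + sum d A" using assms by (intro sum.subset_diff) auto
  moreover have "card (V - A) = card V - card A"
    using assms finite_subset by (intro card_Diff_subset) auto
  ultimately show ?thesis by (simp add: mult.commute)
qed

section \<open>Base case and induction\<close>

text \<open>Two Hamiltonian paths of the 4-cycle, omitting different edges, share the other two
  edges.\<close>

lemma C4_pivotable_square:
  assumes "distinct [p, q, r, s]"
  shows "C4_pivotable {p, q, r, s} {{p, q}, {q, r}, {r, s}, {s, p}}" (is "C4_pivotable ?V ?E")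
proof -
  have single: "tree_graph {x} {}" for x :: 'a
    by (auto simp: tree_graph_iff_card simple_graph_def connected_graph_def)
  have path: "tree_graph {w, x, y, z} {{w, x}, {x, y}, {y, z}}" if "distinct [w, x, y, z]"
    for w x y z :: 'a
    using that tree_graph_add_leaf[OF tree_graph_add_leaf[OF tree_graph_add_leaf[OF single]],
        of z z y y x x w]
    by simp
  let ?T1 = "{{p, q}, {q, r}, {r, s}}"
  let ?T2 = "{{q, r}, {r, s}, {s, p}}"
  have "simple_graph ?V ?E" using assms by (auto simp: simple_graph_def)
  moreover have "card ?E = 4" "card ?V = 4"
    using assms by (auto simp: doubleton_eq_iff)
  then have "int (card ?E) = 2 * int (card ?V) - 4" by simp
  moreover have "spanning_tree ?V ?E ?T1"
    using path[of p q r s] assms by (auto simp: spanning_tree_def)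
  moreover have "spanning_tree ?V ?E ?T2"
  proof -
    have "{q, r, s, p} = ?V" by auto
    then show ?thesis using path[of q r s p] assms by (auto simp: spanning_tree_def)
  qed
  moreover have "induced_cycle ?E [p, q, r, s]"
    using assms by (auto simp: induced_cycle_def is_cycle_def cycle_edges_4)
  moreover have "?T1 \<inter> ?T2 = {{q, r}, {r, s}}" using assms by (auto simp: doubleton_eq_iff)
  moreover have "card {{q, r}, {r, s}} = 2"
    using assms by (auto simp: doubleton_eq_iff)
  ultimately show ?thesis by (rule C4_pivotableI) (auto simp: cycle_edges_4)
qed

text \<open>An arbitrary finite vertex set and unordered degrees suit the induction: deleting a
  vertex and lowering degrees would break both the index range and the order. The sum is stated
  without subtraction.\<close>

lemma ex_C4_pivotable_with_degrees:
  fixes d :: "'a \<Rightarrow> nat"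
  assumes "finite V" "sum d V + 8 = 4 * card V" "\<And>v. v \<in> V \<Longrightarrow> 2 \<le> d v \<and> d v + 2 \<le> card V"
  shows "\<exists>E. C4_pivotable V E \<and> (\<forall>v\<in>V. degree E v = d v)"
  using assms
proof (induction "card V" arbitrary: V d rule: less_induct)
  case less
  note finV = less.prems(1) and total = less.prems(2) and bnd = less.prems(3)
  \<comment> \<open>With \<open>n = card V\<close>, minimum degree 2 gives
    \<open>2 n + 8 <= 4 n\<close>.\<close>
  have card4: "card V \<ge> 4" using sum_ge_card[of V "{}" 2 d] finV total bnd by simp
  consider "card V = 4" | v where "v \<in> V" "d v = 2" "card V \<ge> 5"
    | v where "v \<in> V" "d v = 3" "\<And>u. u \<in> V \<Longrightarrow> d u \<ge> 3"
  proof (cases "card V = 4")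
    case n4: False
    show ?thesis
    proof (cases "\<exists>v\<in>V. d v = 2")
      case True
      then show ?thesis using that(2) n4 card4 by force
    next
      case False
      then have ge3: "d u \<ge> 3" if "u \<in> V" for u using bnd[OF that] that by force
      have "\<exists>v\<in>V. d v = 3"
      proof (rule ccontr)
        assume "\<not> ?thesis"
        \<comment> \<open>All degrees at least 4 would make the sum at least
          \<open>4 n\<close>.\<close>
        then have "4 \<le> d u" if "u \<in> V" for u using ge3[OF that] that by force
        then show False using sum_ge_card[of V "{}" 4 d] finV total by simp
      qed
      then show ?thesis using that(3) ge3 by blast
    qed
  qed (use that in blast)
  then show ?case
  proof cases
    case 1
    then obtain p q r s where V: "V = {p, q, r, s}" and dist: "distinct [p, q, r, s]"
      by (auto simp: card_Suc_eq numeral_eq_Suc)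
    let ?E = "{{p, q}, {q, r}, {r, s}, {s, p}}"
    \<comment> \<open>For four vertices the upper bound \<open>n - 2\<close> meets the lower bound
      2.\<close>
    have d2: "d v = 2" if "v \<in> V" for v using bnd[OF that] 1 by simp
    have notin: "{p, q} \<notin> {{q, r}, {r, s}, {s, p}}" "{q, r} \<notin> {{r, s}, {s, p}}"
      "{r, s} \<notin> {{s, p}}" "{s, p} \<notin> {}"
      using dist by (auto simp: doubleton_eq_iff)
    have "degree ?E v = degree {} v + (if v \<in> {s, p} then 1 else 0) + (if v \<in> {r, s} then 1 else 0)
        + (if v \<in> {q, r} then 1 else 0) + (if v \<in> {p, q} then 1 else 0)" for v
      using notin by (simp only: degree_insert finite.intros not_False_eq_True)
    moreover have "degree {} v = 0" for v :: 'a by (simp add: degree_def)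
    ultimately have "degree ?E v = 2" if "v \<in> V" for v using that V dist by auto
    then have "\<forall>v\<in>V. degree ?E v = d v" using d2 by simp
    then show ?thesis using C4_pivotable_square[OF dist] V by blast
  next
    case (2 v)
    let ?W = "V - {v}"
    have cW: "card ?W = card V - 1" using 2 finV by simp
    then have "?W \<noteq> {}" using 2(3) by (intro notI) (simp only: card.empty)
    then obtain a where a: "a \<in> ?W" "\<And>x. x \<in> ?W \<Longrightarrow> d x \<le> d a"
      using ex_maximizer[of ?W d] finV by auto
    have cWa: "card (?W - {a}) = card V - 2" using a cW finV by simp
    then have "?W - {a} \<noteq> {}" using 2(3) by (intro notI) (simp only: card.empty)
    then obtain b where b: "b \<in> ?W - {a}" "\<And>x. x \<in> ?W - {a} \<Longrightarrow> d x \<le> d b"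
      using ex_maximizer[of "?W - {a}" d] finV by auto
    have ab: "a \<in> V" "b \<in> V" "a \<noteq> b" "a \<noteq> v" "b \<noteq> v" using a b by auto
    \<comment> \<open>The second largest degree must stay at least 2 after being lowered. Otherwise
      the sum is at most \<open>(n - 2) + 2 (n - 1) = 3 n - 4\<close>, which is below
      \<open>4 n - 8\<close> for \<open>n >= 5\<close>.\<close>
    have b3: "d b \<ge> 3"
    proof (rule ccontr)
      assume "\<not> ?thesis"
      then have "d x \<le> 2" if "x \<in> V - {a}" for x
        using b(2)[of x] that 2 by (cases "x = v") auto
      then have "sum d (V - {a}) \<le> card (V - {a}) * 2"
        using sum_bounded_above[of "V - {a}" d 2] by auto
      moreover have "sum d V = d a + sum d (V - {a})" using ab finV by (intro sum.remove)
      moreover have "card (V - {a}) = card V - 1" using ab finV by simp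
      moreover have "d a + 2 \<le> card V" using bnd[OF ab(1)] by simp
      ultimately show False using total 2(3) by linarith
    qed
    have a3: "d a \<ge> 3" using a(2)[of b] b b3 by auto
    define d' where "d' = d(a := d a - 1, b := d b - 1)"
    \<comment> \<open>The upper bound drops by one with the vertex count. A violating
      \<open>x\<close> would make three degrees equal to \<open>n - 2\<close>, and then
      \<open>3 (n - 2) + 2 (n - 3) <= 4 n - 8\<close> fails for \<open>n >= 5\<close>.\<close>
    have others: "d x + 3 \<le> card V" if "x \<in> V" "x \<notin> {v, a, b}" for x
    proof (rule ccontr)
      assume "\<not> ?thesis"
      then have "d x + 2 = card V" using bnd[OF that(1)] by linarith
      moreover have "d x \<le> d b" "d x \<le> d a" using a(2)[of x] b(2)[of x] that by auto
      moreover have "sum d {a, b, x} + 2 * (card V - card {a, b, x}) \<le> sum d V"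
        using finV ab that bnd by (intro sum_ge_card) auto
      moreover have "card {a, b, x} = 3" "sum d {a, b, x} = d a + d b + d x"
        using ab that by auto
      ultimately show False using total 2 by simp
    qed
    have "\<exists>E. C4_pivotable ?W E \<and> (\<forall>u\<in>?W. degree E u = d' u)"
    proof (rule less.hyps)
      show "card ?W < card V" using cW 2 by simp
      show "finite ?W" using finV by simp
      have split: "sum f ?W = f a + (f b + sum f (?W - {a} - {b}))" for f :: "'a \<Rightarrow> nat"
        using sum.remove[of ?W a f] sum.remove[of "?W - {a}" b f] a b finV by simp
      have "sum d' (?W - {a} - {b}) = sum d (?W - {a} - {b})"
        by (intro sum.cong) (auto simp: d'_def)
      then have "sum d' ?W + 2 = sum d ?W"
        using split[of d] split[of d'] ab a3 b3 by (simp add: d'_def)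
      \<comment> \<open>The total drops by 2 for \<open>v\<close> and by 1 for each of
        \<open>a\<close> and \<open>b\<close>, that is by 4 for one vertex fewer.\<close>
      moreover have "sum d V = d v + sum d ?W" using 2 finV by (intro sum.remove)
      ultimately show "sum d' ?W + 8 = 4 * card ?W" using total 2 cW by simp
      fix u assume u: "u \<in> ?W"
      then show "2 \<le> d' u \<and> d' u + 2 \<le> card ?W"
        using bnd[of u] others[of u] a3 b3 cW ab 2(3) by (auto simp: d'_def)
    qed
    then obtain E where E: "C4_pivotable ?W E" "\<And>u. u \<in> ?W \<Longrightarrow> degree E u = d' u" by auto
    let ?E = "insert {v, a} (insert {v, b} E)"
    have sg: "simple_graph ?W E" using E by (auto simp: C4_pivotable_def)
    then have fin: "finite E" by (rule simple_graph_finite_edges)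
    have new: "{v, a} \<notin> E" "{v, b} \<notin> E" "{v, a} \<noteq> {v, b}"
      using sg ab by (auto simp: simple_graph_def doubleton_eq_iff)
    have "insert v ?W = V" using 2 by auto
    then have "C4_pivotable V ?E"
      using C4_pivotable_add_degree_2[OF E(1), of a b v] ab by simp
    moreover have "degree ?E u = d u" if "u \<in> V" for u
      using that E(2)[of u] degree_notin_vertices[OF sg, of v] 2 ab new fin a3 b3
      by (cases "u = v") (auto simp: degree_insert d'_def)
    ultimately show ?thesis by blast
  next
    case (3 v)
    \<comment> \<open>Minimum degree 3 gives \<open>3 n + 8 <= 4 n\<close>.\<close>
    have card8: "card V \<ge> 8" using sum_ge_card[of V "{}" 3 d] finV total 3 by simp
    let ?W = "V - {v}"
    have cW: "card ?W = card V - 1" using 3 finV by simp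
    then have "?W \<noteq> {}" using card8 by (intro notI) (simp only: card.empty)
    then obtain z where z: "z \<in> ?W" "\<And>x. x \<in> ?W \<Longrightarrow> d x \<le> d z"
      using ex_maximizer[of ?W d] finV by auto
    have zV: "z \<in> V" "z \<noteq> v" using z by auto
    \<comment> \<open>Already two vertices of degree \<open>n - 2\<close> are too many here:
      \<open>2 (n - 2) + 3 (n - 2)\<close> exceeds \<open>4 n - 8\<close>. Hence lowering
      \<open>z\<close> alone suffices.\<close>
    have others: "d x + 3 \<le> card V" if "x \<in> V" "x \<notin> {v, z}" for x
    proof (rule ccontr)
      assume "\<not> ?thesis"
      then have "d x + 2 = card V" using bnd[OF that(1)] by linarith
      moreover have "d x \<le> d z" using z(2)[of x] that by auto
      moreover have "sum d {z, x} + 3 * (card V - card {z, x}) \<le> sum d V"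
        using finV zV that 3 by (intro sum_ge_card) auto
      moreover have "card {z, x} = 2" "sum d {z, x} = d z + d x" using that by auto
      ultimately show False using total card8 by simp
    qed
    define d' where "d' = d(z := d z - 1)"
    have z3: "d z \<ge> 3" using 3 zV by blast
    have "\<exists>E. C4_pivotable ?W E \<and> (\<forall>u\<in>?W. degree E u = d' u)"
    proof (rule less.hyps)
      show "card ?W < card V" using cW card8 by simp
      show "finite ?W" using finV by simp
      have split: "sum f ?W = f z + sum f (?W - {z})" for f :: "'a \<Rightarrow> nat"
        using z finV by (intro sum.remove) auto
      have "sum d' (?W - {z}) = sum d (?W - {z})" by (intro sum.cong) (auto simp: d'_def)
      then have "sum d' ?W + 1 = sum d ?W"
        using split[of d] split[of d'] z3 by (simp add: d'_def)
      moreover have "sum d V = d v + sum d ?W" using 3 finV by (intro sum.remove)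
      ultimately show "sum d' ?W + 8 = 4 * card ?W" using total 3 cW card8 by simp
      fix u assume u: "u \<in> ?W"
      then show "2 \<le> d' u \<and> d' u + 2 \<le> card ?W"
        using bnd[of u] others[of u] z3 cW zV card8 by (auto simp: d'_def)
    qed
    then obtain E where E: "C4_pivotable ?W E" "\<And>u. u \<in> ?W \<Longrightarrow> degree E u = d' u" by auto
    have sg: "simple_graph ?W E" and cE: "int (card E) = 2 * int (card ?W) - 4"
      using E by (auto simp: C4_pivotable_def)
    have fin: "finite E" using sg by (rule simple_graph_finite_edges)
    \<comment> \<open>The degree of \<open>z\<close> in \<open>E\<close> is at most
      \<open>n - 3\<close> and \<open>E\<close> has \<open>2 (n - 1) - 4\<close> edges, so
      \<open>n >= 8\<close> is exactly what makes \<open>n + 1 < 2 n - 6\<close>.\<close>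
    have "degree E z + 4 < card E"
      using E(2)[OF z(1)] bnd[OF zV(1)] cE cW card8 z3 by (simp add: d'_def)
    then obtain x y where xy: "{x, y} \<in> E" "x \<noteq> y" "z \<notin> {x, y}" and
      piv: "C4_pivotable (insert v ?W) (insert {v, z} (insert {v, x} (insert {v, y} (E - {{x, y}}))))"
      using C4_pivotable_add_degree_3[OF E(1) z(1), of v] by auto
    let ?E = "insert {v, z} (insert {v, x} (insert {v, y} (E - {{x, y}})))"
    have xyv: "x \<noteq> v" "y \<noteq> v" using xy sg by (auto simp: simple_graph_def)
    have new: "{v, w} \<notin> E" for w using sg by (auto simp: simple_graph_def)
    have new2: "{v, x} \<noteq> {v, y}" "{v, z} \<noteq> {v, x}" "{v, z} \<noteq> {v, y}"
      using xy by (auto simp: doubleton_eq_iff)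
    have pz: "Suc (d z - Suc 0) = d z" using z3 by simp
    have "insert v ?W = V" using 3 by auto
    then have "C4_pivotable V ?E" using piv by simp
    \<comment> \<open>\<open>x\<close> and \<open>y\<close> trade the edge between them for an edge
      to \<open>v\<close>, so only \<open>z\<close> gains a degree, the one taken off in
      \<open>d'\<close>.\<close>
    moreover have "degree ?E u = d u" if "u \<in> V" for u
      using that E(2)[of u] degree_notin_vertices[OF sg, of v] 3(1,2) xy xyv zV new new2 fin pz
        degree_remove[OF fin xy(1), of u]
      by (cases "u = v") (auto simp: degree_insert d'_def)
    ultimately show ?thesis by blast
  qed
qed

theorem theorem4p1:
  fixes n :: nat and d :: "nat \<Rightarrow> nat"
  assumes "n \<ge> 1" and "graphical n d"
  shows "(\<exists>E. realization n d E \<and> C4_pivotable {1..n} E) \<longleftrightarrow>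
     (\<Sum>i = 1..n. int (d i)) = 4 * (int n - 1) - 4 \<and> int (d 1) < int n - 1 \<and> d n \<ge> 2"
    (is "?L \<longleftrightarrow> ?R")
proof
  assume ?L
  then obtain E where E: "realization n d E" "C4_pivotable {1..n} E" by blast
  then have deg: "degree E i = d i" if "i \<in> {1..n}" for i using that by (auto simp: realization_def)
  have sg: "simple_graph {1..n} E" and card: "int (card E) = 2 * int n - 4"
    using E by (auto simp: C4_pivotable_def)
  have "(\<Sum>i = 1..n. d i) = 2 * card E" using sum_degree[OF sg] deg by simp
  then have "(\<Sum>i = 1..n. int (d i)) = 2 * int (card E)"
    by (metis of_nat_mult of_nat_numeral of_nat_sum)
  then show ?R
    using card C4_pivotable_max_degree[OF E(2), of 1] C4_pivotable_min_degree[OF E(2), of n]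
      deg[of 1] deg[of n] assms(1) by auto
next
  assume R: ?R
  have anti: "d j \<le> d i" if "i \<in> {1..n}" "j \<in> {1..n}" "i \<le> j" for i j
    using assms(2) that by (auto simp: graphical_def degree_sequence_def monotone_on_def)
  \<comment> \<open>The integer equation is turned into the subtraction-free one over the
    naturals.\<close>
  have "int (\<Sum>i = 1..n. d i) = 4 * (int n - 1) - 4" using R by simp
  then have "int (sum d {1..n} + 8) = int (4 * n)" by simp
  then have "sum d {1..n} + 8 = 4 * n" by (simp only: of_nat_eq_iff)
  then have "sum d {1..n} + 8 = 4 * card {1..n}" by simp
  \<comment> \<open>By monotonicity the bounds on the first and last entries hold for every
    entry.\<close>
  moreover have "2 \<le> d i \<and> d i + 2 \<le> card {1..n}" if "i \<in> {1..n}" for i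
    using anti[of 1 i] anti[of i n] that R assms(1) by auto
  ultimately obtain E where E: "C4_pivotable {1..n} E" "\<forall>i\<in>{1..n}. degree E i = d i"
    using ex_C4_pivotable_with_degrees[of "{1..n}" d] by auto
  then show ?L by (auto simp: realization_def C4_pivotable_def)
qed

end
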